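(* Let $\alpha\in[2,3]$ be the fixed energy exponent. For every number of players $n\ge 1$ and all job parameters $w_i>0$, $r_i\in\mathbb{R}$, $p_i>0$ ($1\le i\le n$), the deadline game with the marginal cost sharing mechanism admits a pure Nash equilibrium.
   Context: Speed scaling model. A single machine can run at any speed $s(t)\ge 0$ at time $t$; in a time interval $I$ it executes workload $\int_I s(t)\,dt$ and consumes energy $\int_I s(t)^\alpha\,dt$, where $\alpha\in[2,3]$ is a fixed constant. There are $n$ jobs; job $i$ has workload $w_i>0$, release time $r_i$ and deadline $d_i>r_i$. A (preemptive) schedule specifies a speed function and, at each time, at most one job being processed at that speed; it is feasible if each job $i$ receives total workload $w_i$, all of it within $[r_i,d_i]$. $\mathrm{OPT}(d)$ denotes a feasible schedule of minimum energy for deadlines $d=(d_1,\dots,d_n)$, $\mathrm{OPT}(d_{-i})$ denotes a minimum energy feasible schedule for the instance from which job $i$ is removed, and $E(S)$ denotes the energy of a schedule $S$. The game. Player $i$ owns job $i$ and has a priority weight $p_i>0$. The strategy of player $i$ is the choice of a deadline $d_i\in(r_i,\infty)$. In marginal cost sharing, the penalty of player $i$, which he wants to minimize, is $$p_i d_i + E(\mathrm{OPT}(d)) - E(\mathrm{OPT}(d_{-i})).$$ A strategy profile $d$ is a pure Nash equilibrium if no player can strictly decrease his penalty by unilaterally changing his deadline. *)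

theory Defs
  imports "HOL-Analysis.Analysis"
begin

record schedule =
  speed :: "real \<Rightarrow> real"
  job :: "real \<Rightarrow> nat option"  \<comment> \<open>\<open>None\<close>: no job is being processed\<close>

definition wf_schedule :: "schedule \<Rightarrow> bool" where
  "wf_schedule S \<longleftrightarrow>
     speed S \<in> borel_measurable lebesgue \<and> (\<forall>t. 0 \<le> speed S t) \<and>
     job S \<in> measurable lebesgue (count_space UNIV)"

definition workload_in :: "schedule \<Rightarrow> nat \<Rightarrow> real set \<Rightarrow> ennreal" where
  "workload_in S i I = (\<integral>\<^sup>+ t \<in> {t \<in> I. job S t = Some i}. ennreal (speed S t) \<partial>lebesgue)"

text \<open>Energy takes values in \<open>[0, \<infinity>]\<close>, so that a schedule whose energy integral diverges is
  never preferred to one of finite energy.\<close>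

definition energy :: "real \<Rightarrow> schedule \<Rightarrow> ennreal" where
  "energy \<alpha> S = (\<integral>\<^sup>+ t. ennreal (speed S t powr \<alpha>) \<partial>lebesgue)"

text \<open>The instance consists of the jobs in the set \<open>J\<close>; values of \<open>w\<close>, \<open>r\<close>, \<open>d\<close> outside \<open>J\<close>
  are ignored. Equal total workload and workload within \<open>[r i, d i]\<close> means
  that job \<open>i\<close> receives no work outside its interval.\<close>

definition feasible ::
    "nat set \<Rightarrow> (nat \<Rightarrow> real) \<Rightarrow> (nat \<Rightarrow> real) \<Rightarrow> (nat \<Rightarrow> real) \<Rightarrow> schedule \<Rightarrow> bool" where
  "feasible J w r d S \<longleftrightarrow>
     wf_schedule S \<and>
     (\<forall>t i. job S t = Some i \<longrightarrow> i \<in> J) \<and>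
     (\<forall>i\<in>J. workload_in S i UNIV = ennreal (w i) \<and>
             workload_in S i {r i..d i} = ennreal (w i))"

definition OPT ::
    "real \<Rightarrow> nat set \<Rightarrow> (nat \<Rightarrow> real) \<Rightarrow> (nat \<Rightarrow> real) \<Rightarrow> (nat \<Rightarrow> real) \<Rightarrow> schedule" where
  "OPT \<alpha> J w r d = (ARG_MIN (energy \<alpha>) S. feasible J w r d S)"

text \<open>For positive workloads and \<open>d i > r i\<close> there are feasible schedules of finite energy, so
  the optimal energies below are finite and \<open>enn2real\<close> loses nothing.\<close>

definition marginal_penalty ::
    "real \<Rightarrow> nat set \<Rightarrow> (nat \<Rightarrow> real) \<Rightarrow> (nat \<Rightarrow> real) \<Rightarrow> (nat \<Rightarrow> real) \<Rightarrow>
     (nat \<Rightarrow> real) \<Rightarrow> nat \<Rightarrow> real" where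
  "marginal_penalty \<alpha> J w r p d i =
     p i * d i + enn2real (energy \<alpha> (OPT \<alpha> J w r d))
               - enn2real (energy \<alpha> (OPT \<alpha> (J - {i}) w r d))"

definition strategy_profile :: "nat set \<Rightarrow> (nat \<Rightarrow> real) \<Rightarrow> (nat \<Rightarrow> real) \<Rightarrow> bool" where
  "strategy_profile J r d \<longleftrightarrow> (\<forall>i\<in>J. d i \<in> {r i<..})"

definition pure_Nash_equilibrium ::
    "real \<Rightarrow> nat set \<Rightarrow> (nat \<Rightarrow> real) \<Rightarrow> (nat \<Rightarrow> real) \<Rightarrow> (nat \<Rightarrow> real) \<Rightarrow>
     (nat \<Rightarrow> real) \<Rightarrow> bool" where
  "pure_Nash_equilibrium \<alpha> J w r p d \<longleftrightarrow>
     strategy_profile J r d \<and>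
     \<not> (\<exists>i\<in>J. \<exists>x\<in>{r i<..}.
          marginal_penalty \<alpha> J w r p (d(i := x)) i < marginal_penalty \<alpha> J w r p d i)"

end

(* Marginal cost sharing makes the game an exact potential game: a unilateral deviation changes the
   penalty of the deviating player by the same amount as it changes
   Phi(d) = sum p_i d_i + E(OPT(d)). A minimum of Phi is therefore an equilibrium.

   E(OPT(d)) is attained because, on the set of times with a fixed set A of available jobs, Jensen's
   inequality makes constant speed optimal; this leaves a continuous function of the amounts of work
   x(A, i), which range over a compact set.

   For the minimum of Phi, take the limit d of a minimizing sequence of deadlines. A schedule of
   bounded energy performs little work in a short time, so truncating a schedule for nearby
   deadlines at d loses little work, and a small per-job increase of the speed restores it. Hence
   E(OPT(d)) is lower semicontinuous, and also d_i > r_i in the limit. *)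

theory Submission
  imports Defs
begin

section \<open>Measure-theoretic and convexity preliminaries\<close>

text \<open>The measure of the part of \<open>S\<close> up to \<open>u\<close> is nondecreasing and
  1-Lipschitz in \<open>u\<close>, so the intermediate value theorem yields an initial piece of
  \<open>S\<close> of the desired measure.\<close>

lemma exists_subset_of_measure:
  fixes S :: "real set"
  assumes "S \<in> sets lebesgue" "S \<subseteq> {lo..hi}" "0 \<le> a" "a \<le> measure lebesgue S"
  shows "\<exists>B\<subseteq>S. B \<in> sets lebesgue \<and> measure lebesgue B = a"
proof (cases "lo \<le> hi")
  case False
  then have "S = {}" using assms(2) by auto
  then show ?thesis using assms by auto
next
  case True
  define h where "h u = measure lebesgue (S \<inter> {lo..u})" for u
  have fm: "S \<inter> {u..v} \<in> lmeasurable" for u v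
    using assms(1) by (intro fmeasurableI2[OF lmeasurable_interval(1)[of u v]]) auto
  have step: "h u \<le> h v \<and> h v \<le> h u + (v - u)" if "u \<le> v" for u v
  proof
    show "h u \<le> h v" unfolding h_def using that fm
      by (intro measure_mono_fmeasurable) (auto simp: fmeasurableD)
    have "h v \<le> measure lebesgue ((S \<inter> {lo..u}) \<union> {u..v})"
      unfolding h_def using fm that
      by (intro measure_mono_fmeasurable fmeasurable.Un) (auto simp: fmeasurableD)
    also have "\<dots> \<le> h u + measure lebesgue {u..v}"
      unfolding h_def using fm by (intro measure_Un_le) (auto simp: fmeasurableD)
    finally show "h v \<le> h u + (v - u)" using that by simp
  qed
  have cont: "continuous_on {lo..hi} h"
  proof (rule continuous_onI)
    fix x e :: real assume "e > 0"
    have "dist (h x') (h x) \<le> dist x' x" for x'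
      using step[of x x'] step[of x' x] by (cases "x \<le> x'") (auto simp: dist_real_def abs_if)
    then show "\<exists>d>0. \<forall>x'\<in>{lo..hi}. dist x' x < d \<longrightarrow> dist (h x') (h x) \<le> e"
      using \<open>e > 0\<close> by (intro exI[of _ e]) (meson less_le_trans order.strict_implies_order order_le_less_trans)
  qed
  have "h lo \<le> measure lebesgue {lo}" unfolding h_def
    using fmeasurableD[OF fm[of lo lo]] lmeasurable_interval(1)[of lo lo]
    by (intro measure_mono_fmeasurable) auto
  then have "h lo \<le> a" using assms(3) by simp
  moreover have "h hi = measure lebesgue S" unfolding h_def using assms(2) by (simp add: Int_absorb2)
  ultimately obtain u where "h u = a" using IVT'[of h lo a hi] True cont assms(4) by auto
  then show ?thesis unfolding h_def using fm[of lo u]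
    by (intro exI[of _ "S \<inter> {lo..u}"]) (auto simp: fmeasurableD)
qed

text \<open>Preemption permits arbitrary measurable processing sets, so a greedy induction suffices:
  cut a piece for job \<open>k\<close> out of \<open>S\<close> and leave the rest to the other
  jobs.\<close>

lemma exists_allocation_of_measures:
  fixes S :: "real set" and f :: "nat \<Rightarrow> real"
  assumes "finite J" "S \<in> sets lebesgue" "S \<subseteq> {lo..hi}" "\<And>i. i \<in> J \<Longrightarrow> 0 \<le> f i"
    and "sum f J \<le> measure lebesgue S"
  shows "\<exists>g :: real \<Rightarrow> nat option. g \<in> measurable lebesgue (count_space UNIV) \<and>
    (\<forall>t i. g t = Some i \<longrightarrow> i \<in> J \<and> t \<in> S) \<and>
    (\<forall>i\<in>J. measure lebesgue {t. g t = Some i} = f i)"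
  using assms
proof (induction J arbitrary: S rule: finite_induct)
  case empty
  show ?case by (intro exI[of _ "\<lambda>_. None"]) auto
next
  case (insert k J)
  have fmS: "T \<in> lmeasurable" if "T \<in> sets lebesgue" "T \<subseteq> {lo..hi}" for T
    using that by (meson fmeasurableI2 lmeasurable_interval(1))
  have "0 \<le> sum f J" using insert by (intro sum_nonneg) auto
  then have "f k \<le> measure lebesgue S" using insert by auto
  then obtain B where B: "B \<subseteq> S" "B \<in> sets lebesgue" "measure lebesgue B = f k"
    using exists_subset_of_measure[of S lo hi "f k"] insert.prems by auto
  have "measure lebesgue (S - B) = measure lebesgue S - f k"
    using B insert.prems fmeasurableD2[OF fmS[of S]] by (subst measure_Diff) auto
  then have "\<exists>g :: real \<Rightarrow> nat option. g \<in> measurable lebesgue (count_space UNIV) \<and>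
      (\<forall>t i. g t = Some i \<longrightarrow> i \<in> J \<and> t \<in> S - B) \<and>
      (\<forall>i\<in>J. measure lebesgue {t. g t = Some i} = f i)"
    using insert.prems insert.hyps B(2) by (intro insert.IH) auto
  then obtain g where g: "g \<in> measurable lebesgue (count_space UNIV)"
      "\<And>t i. g t = Some i \<Longrightarrow> i \<in> J \<and> t \<in> S - B"
      "\<And>i. i \<in> J \<Longrightarrow> measure lebesgue {t. g t = Some i} = f i"
    by blast
  let ?g = "\<lambda>t. if t \<in> B then Some k else g t"
  have "?g \<in> measurable lebesgue (count_space UNIV)"
    using B g(1) by (intro measurable_If_set) auto
  moreover have "{t. ?g t = Some k} = B" using g(2) insert.hyps by auto
  moreover have "{t. ?g t = Some i} = {t. g t = Some i}" if "i \<in> J" for i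
    using g(2) insert.hyps that by auto
  ultimately show ?case using B g insert.hyps
    by (intro exI[of _ ?g]) (auto split: if_splits)
qed

lemma nn_integral_fibres:
  assumes "finite P" "\<And>t. c t \<in> P" "\<And>A. A \<in> P \<Longrightarrow> {t. c t = A} \<in> sets lebesgue"
    and "f \<in> borel_measurable lebesgue"
  shows "(\<integral>\<^sup>+ t. f t \<partial>lebesgue) = (\<Sum>A\<in>P. \<integral>\<^sup>+ t\<in>{t. c t = A}. f t \<partial>lebesgue)"
proof -
  have "f t = (\<Sum>A\<in>P. f t * indicator {t. c t = A} t)" for t
  proof -
    have "(\<Sum>A\<in>P. f t * indicator {t. c t = A} t) = (\<Sum>A\<in>P. if A = c t then f t else 0)"
      by (intro sum.cong) (auto simp: indicator_def)
    then show ?thesis using assms(1,2) by simp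
  qed
  then have "(\<integral>\<^sup>+ t. f t \<partial>lebesgue) = (\<integral>\<^sup>+ t. (\<Sum>A\<in>P. f t * indicator {t. c t = A} t) \<partial>lebesgue)"
    by simp
  also have "\<dots> = (\<Sum>A\<in>P. \<integral>\<^sup>+ t\<in>{t. c t = A}. f t \<partial>lebesgue)"
    using assms by (intro nn_integral_sum borel_measurable_times_ennreal borel_measurable_indicator) auto
  finally show ?thesis .
qed

text \<open>The graph of a convex power lies above its tangent at \<open>m\<close>; the terms are
  arranged so that none is negative. Scaling by \<open>m\<close> reduces the claim to the tangent at
  1. The point 0 is separate because convexity is applied on the open half-line.\<close>

lemma powr_tangent:
  fixes s m \<alpha> :: real
  assumes "1 < \<alpha>" "0 \<le> s" "0 < m"
  shows "\<alpha> * m powr (\<alpha> - 1) * s \<le> s powr \<alpha> + (\<alpha> - 1) * m powr \<alpha>"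
proof (cases "s = 0")
  case True
  then show ?thesis using assms by simp
next
  case False
  define u where "u = s / m"
  have u: "u > 0" using False assms by (simp add: u_def)
  have "((\<lambda>x::real. x powr \<alpha>) has_real_derivative \<alpha> * 1 powr (\<alpha> - 1)) (at 1 within {0<..})"
    by (auto intro!: derivative_eq_intros)
  then have "u powr \<alpha> - 1 powr \<alpha> \<ge> (\<alpha> * 1 powr (\<alpha> - 1)) * (u - 1)"
    using u assms by (intro convex_on_imp_above_tangent[where A="{0<..}"] powr_convex)
      (auto simp: interior_open)
  then have "1 + \<alpha> * (u - 1) \<le> u powr \<alpha>" by simp
  then have "m powr \<alpha> * (1 + \<alpha> * (u - 1)) \<le> m powr \<alpha> * u powr \<alpha>"
    by (intro mult_left_mono) auto
  moreover have "m powr \<alpha> * u powr \<alpha> = s powr \<alpha>"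
    using assms u by (simp add: u_def powr_divide)
  moreover have "m powr \<alpha> * u = m powr (\<alpha> - 1) * s"
    using assms by (simp add: u_def powr_diff)
  ultimately show ?thesis by (simp add: algebra_simps)
qed


section \<open>Workload as a function of the set of times\<close>

text \<open>With the job indicator in the integrand, the function integrated no longer depends on
  \<open>I\<close>, so facts about integrals over varying sets apply.\<close>

lemma workload_in_eq:
  "workload_in S i I = (\<integral>\<^sup>+ t\<in>I. ennreal (speed S t) * indicator {t. job S t = Some i} t \<partial>lebesgue)"
  unfolding workload_in_def by (intro nn_integral_cong) (auto simp: indicator_def)

lemma workload_integrand_measurable:
  assumes "wf_schedule S"
  shows "(\<lambda>t. ennreal (speed S t) * indicator {t. job S t = Some i} t) \<in> borel_measurable lebesgue"
proof -
  have "job S -` {Some i} \<inter> space lebesgue \<in> sets lebesgue"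
    using assms unfolding wf_schedule_def by (intro measurable_sets[where A="count_space UNIV"]) auto
  then have "{t. job S t = Some i} \<in> sets lebesgue"
    by (simp add: vimage_def)
  moreover have "speed S \<in> borel_measurable lebesgue"
    using assms by (simp add: wf_schedule_def)
  ultimately show ?thesis by measurable
qed

lemma workload_in_mono: "A \<subseteq> B \<Longrightarrow> workload_in S i A \<le> workload_in S i B"
  unfolding workload_in_eq by (intro nn_integral_mono) (auto simp: indicator_def)

lemma workload_in_Un:
  assumes "wf_schedule S" "A \<in> sets lebesgue" "B \<in> sets lebesgue" "A \<inter> B = {}"
  shows "workload_in S i (A \<union> B) = workload_in S i A + workload_in S i B"
proof -
  note [measurable] = workload_integrand_measurable[OF assms(1), of i] assms(2,3)
  have "workload_in S i (A \<union> B) =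
    (\<integral>\<^sup>+ t. ennreal (speed S t) * indicator {t. job S t = Some i} t * indicator A t
         + ennreal (speed S t) * indicator {t. job S t = Some i} t * indicator B t \<partial>lebesgue)"
    unfolding workload_in_eq using assms(4) by (intro nn_integral_cong) (auto simp: indicator_def)
  also have "\<dots> = workload_in S i A + workload_in S i B"
    unfolding workload_in_eq by (intro nn_integral_add) measurable
  finally show ?thesis .
qed

lemma workload_in_null:
  assumes "I \<in> sets lebesgue" "emeasure lebesgue I = 0"
  shows "workload_in S i I = 0"
proof -
  have "I \<in> null_sets lebesgue" using assms by (intro null_setsI)
  then show ?thesis unfolding workload_in_eq by (rule nn_integral_null_set)
qed

text \<open>The total work and the work inside the window are the same finite number, which may
  therefore be cancelled.\<close>

lemma feasible_workload_outside:
  assumes "feasible J w r d S" "i \<in> J" "I \<inter> {r i..d i} = {}"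
  shows "workload_in S i I = 0"
proof -
  have "workload_in S i ({r i..d i} \<union> - {r i..d i}) =
      workload_in S i {r i..d i} + workload_in S i (- {r i..d i})"
    using assms by (intro workload_in_Un) (auto simp: feasible_def)
  then have "ennreal (w i) + workload_in S i (- {r i..d i}) = ennreal (w i) + 0"
    using assms by (simp add: feasible_def)
  then have "workload_in S i (- {r i..d i}) = 0"
    by (subst (asm) ennreal_add_left_cancel) simp
  then show ?thesis
    using workload_in_mono[of I "- {r i..d i}" S i] assms(3) by (auto simp: disjoint_eq_subset_Compl)
qed

section \<open>Existence of a minimum energy schedule for fixed deadlines\<close>

locale deadline_instance =
  fixes \<alpha> :: real and J :: "nat set" and w r d :: "nat \<Rightarrow> real"
  assumes exponent: "1 < \<alpha>" and finite_J: "finite J"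
    and workload_pos: "i \<in> J \<Longrightarrow> 0 < w i" and release_less: "i \<in> J \<Longrightarrow> r i < d i"
begin

text \<open>Grouping times by the set of available jobs avoids sorting the release times and deadlines.\<close>

definition active :: "real \<Rightarrow> nat set" where
  "active t = {i \<in> J. r i \<le> t \<and> t \<le> d i}"

abbreviation cell :: "nat set \<Rightarrow> real set" where
  "cell A \<equiv> {t. active t = A}"

abbreviation len :: "nat set \<Rightarrow> real" where
  "len A \<equiv> measure lebesgue (cell A)"

lemma active_Pow: "active t \<in> Pow J"
  by (auto simp: active_def)

lemma cell_sets: "cell A \<in> sets lebesgue"
proof (cases "A \<subseteq> J")
  case True
  then have "cell A = {t \<in> space borel. \<forall>i\<in>J. (r i \<le> t \<and> t \<le> d i) = (i \<in> A)}"
    by (auto simp: active_def)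
  also have "\<dots> \<in> sets borel"
    using finite_J by measurable
  finally show ?thesis by simp
next
  case False
  then have "cell A = {}" using active_Pow by auto
  then show ?thesis by simp
qed

lemma cell_subset: "i \<in> A \<Longrightarrow> cell A \<subseteq> {r i..d i}"
  by (auto simp: active_def)

lemma emeasure_cell: "i \<in> A \<Longrightarrow> emeasure lebesgue (cell A) = ennreal (len A)"
  using cell_subset[of i A] cell_sets[of A]
  by (intro emeasure_eq_measure2) (metis fmeasurableI2 lmeasurable_interval(1))

lemmas nn_integral_cells =
  nn_integral_fibres[of "Pow J" active, OF _ active_Pow cell_sets, simplified finite_Pow_iff, OF finite_J]

lemma workload_in_cells:
  assumes "wf_schedule S"
  shows "workload_in S i UNIV = (\<Sum>A\<in>Pow J. workload_in S i (cell A))"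
  using nn_integral_cells[OF workload_integrand_measurable[OF assms, of i]]
  by (simp add: workload_in_eq)

text \<open>\<open>x (A, i)\<close> stands for the work done on job \<open>i\<close> while exactly
  the jobs in \<open>A\<close> are available. All irrelevant coordinates are pinned to 0, so that
  the set lies in a compact box of the full function space.\<close>

definition allocations :: "(nat set \<times> nat \<Rightarrow> real) set" where
  "allocations = {x. (\<forall>k. 0 \<le> x k) \<and>
     (\<forall>A i. i \<notin> A \<or> len A = 0 \<or> A \<notin> Pow J \<or> i \<notin> J \<longrightarrow> x (A, i) = 0) \<and>
     (\<forall>i\<in>J. (\<Sum>A\<in>Pow J. x (A, i)) = w i)}"

text \<open>On null cells (and on \<open>{}\<close>, whose cell has infinite measure, so that \<open>len {} = 0\<close> is a junk
  value) allocations vanish, so the quotient below is the intended \<open>0\<close>.\<close>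

definition pooled_speed :: "(nat set \<times> nat \<Rightarrow> real) \<Rightarrow> nat set \<Rightarrow> real" where
  "pooled_speed x A = (\<Sum>i\<in>J. x (A, i)) / len A"

definition pooled_energy :: "(nat set \<times> nat \<Rightarrow> real) \<Rightarrow> real" where
  "pooled_energy x = (\<Sum>A\<in>Pow J. len A * pooled_speed x A powr \<alpha>)"

text \<open>Recording how much work \<open>S\<close> does on each job in each cell gives the
  allocation. Replacing the speed on a cell by its average cannot increase the energy.\<close>

lemma feasible_allocation:
  assumes S: "feasible J w r d S"
  shows "\<exists>x\<in>allocations. ennreal (pooled_energy x) \<le> energy \<alpha> S"
proof
  have wf: "wf_schedule S" using S by (simp add: feasible_def)
  then have [measurable]: "speed S \<in> borel_measurable lebesgue" and nonneg: "\<And>t. 0 \<le> speed S t"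
    by (auto simp: wf_schedule_def)
  define x where "x = (\<lambda>(A, i). if A \<in> Pow J \<and> i \<in> J then enn2real (workload_in S i (cell A)) else 0)"
  have x: "ennreal (x (A, i)) = workload_in S i (cell A)" if "A \<in> Pow J" "i \<in> J" for A i
  proof -
    have "workload_in S i (cell A) \<le> ennreal (w i)"
      using workload_in_mono[of "cell A" UNIV S i] S that by (simp add: feasible_def)
    then show ?thesis using that by (auto simp: x_def intro!: ennreal_enn2real le_less_trans[OF _ ennreal_less_top])
  qed
  have x0: "0 \<le> x k" for k by (auto simp: x_def split: prod.splits)
  show "x \<in> allocations"
    unfolding allocations_def
  proof (intro CollectI conjI allI ballI impI)
    fix A i assume "i \<notin> A \<or> len A = 0 \<or> A \<notin> Pow J \<or> i \<notin> J"
    \<comment> \<open>A cell whose set omits \<open>i\<close> misses the window of \<open>i\<close>;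
      a null cell carries no work at all.\<close>
    moreover have "workload_in S i (cell A) = 0" if "i \<in> J" "i \<notin> A"
      using that by (intro feasible_workload_outside[OF S]) (auto simp: active_def)
    moreover have "workload_in S i (cell A) = 0" if "i \<in> A" "len A = 0"
      using that by (intro workload_in_null cell_sets) (simp add: emeasure_cell)
    ultimately show "x (A, i) = 0" by (cases "i \<in> A") (auto simp: x_def)
  next
    fix i assume i: "i \<in> J"
    have "ennreal (\<Sum>A\<in>Pow J. x (A, i)) = (\<Sum>A\<in>Pow J. workload_in S i (cell A))"
      using x x0 i by (simp add: sum_ennreal[symmetric])
    also have "\<dots> = ennreal (w i)"
      using workload_in_cells[OF wf] S i by (simp add: feasible_def)
    finally show "(\<Sum>A\<in>Pow J. x (A, i)) = w i"
      using workload_pos[OF i] by (subst (asm) ennreal_inj) (auto intro: sum_nonneg x0)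
  qed (rule x0)
  have cell_energy: "ennreal (len A * pooled_speed x A powr \<alpha>)
      \<le> (\<integral>\<^sup>+ t\<in>cell A. ennreal (speed S t powr \<alpha>) \<partial>lebesgue)" if A: "A \<in> Pow J" for A
  \<comment> \<open>Division by 0 gives 0, so this case absorbs the null cells and the cell of
    \<open>{}\<close>. Otherwise \<open>len A\<close> is positive and hence the true, finite
    measure.\<close>
  proof (cases "pooled_speed x A = 0")
    case True
    then show ?thesis by simp
  next
    case False
    note [measurable] = cell_sets[of A]
    define X where "X = (\<Sum>i\<in>J. x (A, i))"
    define m where "m = pooled_speed x A"
    have "0 \<le> X" by (auto simp: X_def intro: sum_nonneg x0)
    have len: "0 < len A" using False by (auto simp: pooled_speed_def zero_less_measure_iff)
    have m: "m > 0" "m * len A = X"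
      using False len \<open>0 \<le> X\<close> by (auto simp: m_def pooled_speed_def X_def[symmetric])
    have em: "emeasure lebesgue (cell A) = ennreal (len A)"
      using len by (intro emeasure_eq_ennreal_measure) (auto simp: measure_def)
    \<comment> \<open>Jensen's inequality, by integrating the tangent at the average speed \<open>m\<close>; \<open>?b\<close> stays on the
      right-hand side to avoid subtraction in \<^typ>\<open>ennreal\<close>.\<close>
    let ?c = "\<alpha> * m powr (\<alpha> - 1)" and ?b = "(\<alpha> - 1) * m powr \<alpha>"
    let ?E = "\<integral>\<^sup>+ t\<in>cell A. ennreal (speed S t powr \<alpha>) \<partial>lebesgue"
    have c0: "0 \<le> ?c" "0 \<le> ?b" using exponent by auto
    have "ennreal X = (\<Sum>i\<in>J. workload_in S i (cell A))"
      using x x0 A by (simp add: X_def sum_ennreal[symmetric])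
    also have "\<dots> = (\<integral>\<^sup>+ t. (\<Sum>i\<in>J. ennreal (speed S t) * indicator {t. job S t = Some i} t
         * indicator (cell A) t) \<partial>lebesgue)"
      unfolding workload_in_eq
      by (intro nn_integral_sum[symmetric] borel_measurable_times_ennreal[OF workload_integrand_measurable[OF wf]]
          borel_measurable_indicator cell_sets)
    \<comment> \<open>At any time at most one job is processed, so the job indicators sum to at most
      1.\<close>
    also have "\<dots> \<le> (\<integral>\<^sup>+ t\<in>cell A. ennreal (speed S t) \<partial>lebesgue)"
    proof (intro nn_integral_mono)
      fix t
      have "(\<Sum>i\<in>J. indicator {t. job S t = Some i} t :: ennreal) = (\<Sum>i\<in>J. if job S t = Some i then 1 else 0)"
        by (intro sum.cong) (auto simp: indicator_def)
      also have "\<dots> \<le> 1"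
      proof (cases "job S t")
        case (Some k)
        then have "(\<Sum>i\<in>J. if job S t = Some i then 1 else 0 :: ennreal) = (\<Sum>i\<in>J. if k = i then 1 else 0)"
          by simp
        then show ?thesis using finite_J by simp
      qed simp
      finally have "(\<Sum>i\<in>J. indicator {t. job S t = Some i} t :: ennreal) \<le> 1" .
      then have "(ennreal (speed S t) * indicator (cell A) t) * (\<Sum>i\<in>J. indicator {t. job S t = Some i} t)
          \<le> (ennreal (speed S t) * indicator (cell A) t) * 1"
        by (rule mult_left_mono) simp
      then show "(\<Sum>i\<in>J. ennreal (speed S t) * indicator {t. job S t = Some i} t * indicator (cell A) t)
          \<le> ennreal (speed S t) * indicator (cell A) t"
        by (simp add: sum_distrib_left mult_ac)
    qed
    finally have "ennreal ?c * ennreal X \<le> ennreal ?c * (\<integral>\<^sup>+ t\<in>cell A. ennreal (speed S t) \<partial>lebesgue)"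
      by (rule mult_left_mono) simp
    also have "\<dots> = (\<integral>\<^sup>+ t. ennreal ?c * (ennreal (speed S t) * indicator (cell A) t) \<partial>lebesgue)"
      by (intro nn_integral_cmult[symmetric]) measurable
    also have "\<dots> \<le> (\<integral>\<^sup>+ t. ennreal (speed S t powr \<alpha>) * indicator (cell A) t
        + ennreal ?b * indicator (cell A) t \<partial>lebesgue)"
    proof (intro nn_integral_mono)
      fix t
      show "ennreal ?c * (ennreal (speed S t) * indicator (cell A) t)
        \<le> ennreal (speed S t powr \<alpha>) * indicator (cell A) t + ennreal ?b * indicator (cell A) t"
        using powr_tangent[OF exponent nonneg m(1), of t] c0 nonneg[of t]
        by (auto simp: indicator_def ennreal_mult[symmetric] ennreal_plus[symmetric] ennreal_leI
            simp del: ennreal_plus)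
    qed
    also have "\<dots> = ?E + ennreal ?b * ennreal (len A)"
      by (subst nn_integral_add) (auto simp: nn_integral_cmult_indicator em cell_sets)
    finally have *: "ennreal (?c * X) \<le> ?E + ennreal (?b * len A)"
      using c0 \<open>0 \<le> X\<close> by (simp add: ennreal_mult)
    \<comment> \<open>As \<open>m\<close> is the average speed, the two tangent terms combine to
      exactly the energy of running the cell at constant speed \<open>m\<close>.\<close>
    have "?c * X = \<alpha> * (m powr \<alpha> * len A)"
      using m by (simp add: powr_diff flip: m(2))
    then have "?c * X - ?b * len A = len A * m powr \<alpha>"
      by (simp add: algebra_simps)
    \<comment> \<open>Subtracting the second tangent term requires a finite energy integral; an
      infinite one makes the bound trivial.\<close>
    show ?thesis
    proof (cases ?E)
      case (real e)
      then have "ennreal (?c * X) \<le> ennreal (e + ?b * len A)"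
        using * c0 by simp
      then have "?c * X \<le> e + ?b * len A"
        using real c0 by (subst (asm) ennreal_le_iff) auto
      then have "len A * m powr \<alpha> \<le> e" using \<open>?c * X - ?b * len A = len A * m powr \<alpha>\<close> by linarith
      then show ?thesis using real by (simp add: m_def ennreal_leI)
    qed simp
  qed
  have "ennreal (pooled_energy x) = (\<Sum>A\<in>Pow J. ennreal (len A * pooled_speed x A powr \<alpha>))"
    by (simp add: pooled_energy_def sum_ennreal)
  also have "\<dots> \<le> (\<Sum>A\<in>Pow J. \<integral>\<^sup>+ t\<in>cell A. ennreal (speed S t powr \<alpha>) \<partial>lebesgue)"
    by (intro sum_mono cell_energy)
  also have "\<dots> = energy \<alpha> S"
    unfolding energy_def by (intro nn_integral_cells[symmetric]) measurable
  finally show "ennreal (pooled_energy x) \<le> energy \<alpha> S" .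
qed

text \<open>The prescribed measure is the time job \<open>i\<close> needs at the pooled speed. These
  times add up to \<open>len A\<close>, or to 0 if the cell has no work. The empty set is separate
  because its cell is unbounded.\<close>

lemma cell_allocation:
  assumes x: "x \<in> allocations" and A: "A \<in> Pow J"
  shows "\<exists>g :: real \<Rightarrow> nat option. g \<in> measurable lebesgue (count_space UNIV) \<and>
    (\<forall>t i. g t = Some i \<longrightarrow> i \<in> A \<and> t \<in> cell A) \<and>
    (\<forall>i\<in>A. measure lebesgue {t. g t = Some i} = len A * x (A, i) / (\<Sum>i\<in>J. x (A, i)))"
proof (cases "A = {}")
  case True
  then show ?thesis by (intro exI[of _ "\<lambda>_. None"]) auto
next
  case False
  then obtain k where k: "k \<in> A" by auto
  have x0: "0 \<le> x y" for y using x unfolding allocations_def by blast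
  have "(\<Sum>i\<in>A. x (A, i)) = (\<Sum>i\<in>J. x (A, i))"
    using A finite_J x by (intro sum.mono_neutral_left) (auto simp: allocations_def)
  then have "(\<Sum>i\<in>A. len A * x (A, i) / (\<Sum>i\<in>J. x (A, i))) \<le> len A"
    by (simp add: sum_divide_distrib[symmetric] sum_distrib_left[symmetric])
  then show ?thesis
    using A k x0 finite_J by (intro exists_allocation_of_measures[OF _ cell_sets cell_subset[OF k]])
      (auto intro!: divide_nonneg_nonneg mult_nonneg_nonneg sum_nonneg intro: finite_subset)
qed

text \<open>Converse of \<open>feasible_allocation\<close>: each cell runs at its pooled speed and
  its time is shared in proportion to the work. Together the two lemmas turn the search for an
  optimal schedule into minimization over \<open>allocations\<close>.\<close>

lemma allocation_schedule:
  assumes x: "x \<in> allocations"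
  shows "\<exists>S. feasible J w r d S \<and> energy \<alpha> S = ennreal (pooled_energy x)"
proof -
  let ?X = "\<lambda>A. \<Sum>i\<in>J. x (A, i)"
  have x0: "0 \<le> x y" for y using x unfolding allocations_def by blast
  have v0: "0 \<le> pooled_speed x A" for A by (auto simp: pooled_speed_def intro!: divide_nonneg_nonneg sum_nonneg x0)
  have "\<forall>A\<in>Pow J. \<exists>g :: real \<Rightarrow> nat option. g \<in> measurable lebesgue (count_space UNIV) \<and>
    (\<forall>t i. g t = Some i \<longrightarrow> i \<in> A \<and> t \<in> cell A) \<and>
    (\<forall>i\<in>A. measure lebesgue {t. g t = Some i} = len A * x (A, i) / ?X A)"
    using cell_allocation[OF x] by blast
  then obtain g :: "nat set \<Rightarrow> real \<Rightarrow> nat option" where g: "\<forall>A\<in>Pow J.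
    g A \<in> measurable lebesgue (count_space UNIV) \<and>
    (\<forall>t i. g A t = Some i \<longrightarrow> i \<in> A \<and> t \<in> cell A) \<and>
    (\<forall>i\<in>A. measure lebesgue {t. g A t = Some i} = len A * x (A, i) / ?X A)"
    by (rule bchoice[elim_format]) blast
  have g_meas: "g A \<in> measurable lebesgue (count_space UNIV)" if "A \<in> Pow J" for A
    using bspec[OF g that] by (rule conjunct1)
  have g_Some: "i \<in> A \<and> t \<in> cell A" if "A \<in> Pow J" "g A t = Some i" for A t i
    using bspec[OF g that(1)] that(2) by (elim conjE) blast
  have g_measure: "measure lebesgue {t. g A t = Some i} = len A * x (A, i) / ?X A"
    if "A \<in> Pow J" "i \<in> A" for A i
    using bspec[OF g that(1)] that(2) by (elim conjE) (rule bspec)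
  define S where "S = \<lparr>speed = (\<lambda>t. pooled_speed x (active t)), job = (\<lambda>t. g (active t) t)\<rparr>"
  \<comment> \<open>There are finitely many cells, all measurable. So both the speed, constant on
    cells, and the job function, glued from the \<open>g A\<close>, are measurable.\<close>
  have active_meas: "active \<in> measurable lebesgue (count_space (Pow J))"
  proof (subst measurable_count_space_eq2)
    show "finite (Pow J)" using finite_J by simp
    have "active -` {A} \<inter> space lebesgue \<in> sets lebesgue" for A
      using cell_sets[of A] by (simp add: vimage_def)
    then show "active \<in> space lebesgue \<rightarrow> Pow J \<and>
        (\<forall>A\<in>Pow J. active -` {A} \<inter> space lebesgue \<in> sets lebesgue)"
      using active_Pow by blast
  qed
  have "(\<lambda>t. pooled_speed x (active t)) \<in> borel_measurable lebesgue"
    using active_meas by (rule measurable_compose) simp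
  moreover have "(\<lambda>t. g (active t) t) \<in> measurable lebesgue (count_space UNIV)"
    by (rule measurable_compose_countable'[OF g_meas active_meas])
      (auto intro: countable_finite simp: finite_J)
  ultimately have wf: "wf_schedule S"
    by (simp add: wf_schedule_def S_def v0)
  have job: "i \<in> active t" if "job S t = Some i" for t i
    using g_Some[OF active_Pow, of t t i] that by (simp add: S_def)
  have work: "workload_in S i (cell A) = ennreal (x (A, i))" if A: "A \<in> Pow J" and i: "i \<in> J" for A i
  proof (cases "i \<in> A")
    case False
    then have "job S t \<noteq> Some i" if "active t = A" for t using job[of t i] that by blast
    then have "workload_in S i (cell A) = (\<integral>\<^sup>+ (t::real). 0 \<partial>lebesgue)"
      unfolding workload_in_eq by (intro nn_integral_cong) (simp add: indicator_def, blast)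
    moreover have "x (A, i) = 0" using x False unfolding allocations_def by blast
    ultimately show ?thesis by simp
  next
    case True
    let ?G = "{t. g A t = Some i}"
    have G: "?G \<in> sets lebesgue" "?G \<subseteq> cell A"
      using measurable_sets[OF g_meas[OF A], of "{Some i}"] g_Some[OF A] by (auto simp: vimage_def)
    then have "?G \<in> lmeasurable"
      using cell_subset[OF True] by (intro fmeasurableI2[OF lmeasurable_interval(1)[of "r i" "d i"]]) auto
    then have "emeasure lebesgue ?G = ennreal (len A * x (A, i) / ?X A)"
      using g_measure[OF A True] by (simp add: emeasure_eq_measure2)
    \<comment> \<open>Speed times time is the required work. In the degenerate cases, where a
      division by 0 occurs, \<open>x (A, i)\<close> is 0 as well.\<close>
    moreover have "pooled_speed x A * (len A * x (A, i) / ?X A) = x (A, i)"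
    proof (cases "len A = 0 \<or> ?X A = 0")
      case True
      then have "x (A, i) = 0"
        using x i A finite_J x0 by (auto simp: allocations_def sum_nonneg_eq_0_iff)
      then show ?thesis by simp
    qed (simp add: pooled_speed_def)
    moreover have "workload_in S i (cell A) = (\<integral>\<^sup>+ t. ennreal (pooled_speed x A) * indicator ?G t \<partial>lebesgue)"
      unfolding workload_in_eq using G(2)
      by (intro nn_integral_cong) (auto simp: indicator_def S_def)
    ultimately show ?thesis
      using G(1) x0 v0 by (simp add: nn_integral_cmult_indicator ennreal_mult'[symmetric])
  qed
  have total: "workload_in S i UNIV = ennreal (w i)" if i: "i \<in> J" for i
    using workload_in_cells[OF wf, of i] x i x0
    by (simp add: work sum_ennreal allocations_def del: Pow_iff)
  have "workload_in S i {r i..d i} = workload_in S i UNIV" for i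
    unfolding workload_in_eq using job
    by (intro nn_integral_cong) (auto simp: indicator_def active_def)
  with wf total job have "feasible J w r d S"
    by (auto simp: feasible_def active_def)
  moreover have "energy \<alpha> S = ennreal (pooled_energy x)"
  proof -
    have [measurable]: "speed S \<in> borel_measurable lebesgue" using wf by (simp add: wf_schedule_def)
    have "(\<integral>\<^sup>+ t\<in>cell A. ennreal (speed S t powr \<alpha>) \<partial>lebesgue) = ennreal (len A * pooled_speed x A powr \<alpha>)"
      if "A \<in> Pow J" for A
    proof -
      have "(\<integral>\<^sup>+ t\<in>cell A. ennreal (speed S t powr \<alpha>) \<partial>lebesgue)
          = (\<integral>\<^sup>+ t. ennreal (pooled_speed x A powr \<alpha>) * indicator (cell A) t \<partial>lebesgue)"
        by (intro nn_integral_cong) (auto simp: indicator_def S_def)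
      also have "\<dots> = ennreal (pooled_speed x A powr \<alpha>) * emeasure lebesgue (cell A)"
        by (intro nn_integral_cmult_indicator cell_sets)
      also have "\<dots> = ennreal (len A * pooled_speed x A powr \<alpha>)"
      \<comment> \<open>The cell of \<open>{}\<close> has infinite measure, but its speed is 0, and
        the product with infinity is 0 in \<open>ennreal\<close>.\<close>
      proof (cases "A = {}")
        case True
        then have "pooled_speed x A = 0" using x by (auto simp: pooled_speed_def allocations_def)
        then show ?thesis by simp
      next
        case False
        then show ?thesis by (auto simp: emeasure_cell ennreal_mult mult.commute)
      qed
      finally show ?thesis .
    qed
    then have "(\<Sum>A\<in>Pow J. \<integral>\<^sup>+ t\<in>cell A. ennreal (speed S t powr \<alpha>) \<partial>lebesgue)
        = (\<Sum>A\<in>Pow J. ennreal (len A * pooled_speed x A powr \<alpha>))"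
      by (intro sum.cong refl)
    also have "\<dots> = ennreal (pooled_energy x)"
      unfolding pooled_energy_def by (intro sum_ennreal) simp
    finally have "(\<Sum>A\<in>Pow J. \<integral>\<^sup>+ t\<in>cell A. ennreal (speed S t powr \<alpha>) \<partial>lebesgue)
        = ennreal (pooled_energy x)" .
    moreover have "energy \<alpha> S = (\<Sum>A\<in>Pow J. \<integral>\<^sup>+ t\<in>cell A. ennreal (speed S t powr \<alpha>) \<partial>lebesgue)"
      unfolding energy_def by (intro nn_integral_cells) measurable
    ultimately show ?thesis by simp
  qed
  ultimately show ?thesis by blast
qed

text \<open>Spread each job evenly over its window. The cells whose set contains \<open>i\<close>
  partition that window, so their lengths sum to \<open>d i - r i\<close>.\<close>

lemma allocations_nonempty: "allocations \<noteq> {}"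
proof -
  define x where "x = (\<lambda>(A, i). if A \<in> Pow J \<and> i \<in> J \<and> i \<in> A then w i / (d i - r i) * len A else 0)"
  have "(\<Sum>A\<in>Pow J. x (A, i)) = w i" if i: "i \<in> J" for i
  proof -
    let ?l = "\<lambda>A. if i \<in> A then len A else 0"
    have "ennreal (d i - r i) = emeasure lebesgue {r i..d i}"
      using release_less[OF i] by simp
    also have "\<dots> = (\<integral>\<^sup>+ t. indicator {r i..d i} t \<partial>lebesgue)"
      by simp
    also have "\<dots> = (\<Sum>A\<in>Pow J. \<integral>\<^sup>+ t\<in>cell A. indicator {r i..d i} t \<partial>lebesgue)"
      by (intro nn_integral_cells borel_measurable_indicator) simp
    also have "\<dots> = (\<Sum>A\<in>Pow J. ennreal (?l A))"
    proof (intro sum.cong refl)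
      fix A assume "A \<in> Pow J"
      have "(\<integral>\<^sup>+ t\<in>cell A. indicator {r i..d i} t \<partial>lebesgue)
          = (\<integral>\<^sup>+ t. (if i \<in> A then indicator (cell A) t else 0) \<partial>lebesgue)"
        using i by (intro nn_integral_cong) (auto simp: indicator_def active_def)
      then show "(\<integral>\<^sup>+ t\<in>cell A. indicator {r i..d i} t \<partial>lebesgue) = ennreal (?l A)"
        by (simp add: nn_integral_indicator cell_sets emeasure_cell del: emeasure_completion)
    qed
    also have "\<dots> = ennreal (\<Sum>A\<in>Pow J. ?l A)"
      by (simp add: sum_ennreal)
    finally have total: "(\<Sum>A\<in>Pow J. ?l A) = d i - r i"
      using release_less[OF i] by (subst (asm) ennreal_inj) (auto intro: sum_nonneg)
    have "(\<Sum>A\<in>Pow J. x (A, i)) = (\<Sum>A\<in>Pow J. w i / (d i - r i) * ?l A)"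
      using i by (intro sum.cong) (auto simp: x_def)
    then have "(\<Sum>A\<in>Pow J. x (A, i)) = w i / (d i - r i) * (d i - r i)"
      by (simp only: sum_distrib_left[symmetric] total)
    then show ?thesis
      using release_less[OF i] by simp
  qed
  then have "x \<in> allocations"
    using workload_pos release_less unfolding allocations_def
    by (auto simp: x_def less_imp_le)
  then show ?thesis by blast
qed

text \<open>A closed subset of a box, which is compact by Tychonoff's theorem. The total workload
  bounds every coordinate, and each constraint involves only finitely many coordinates.\<close>

lemma compact_allocations: "compact allocations"
proof -
  define W where "W = sum w J"
  have w0: "0 \<le> w i" if "i \<in> J" for i using workload_pos[OF that] by simp
  let ?B = "PiE UNIV (\<lambda>_. {0..W}) :: (nat set \<times> nat \<Rightarrow> real) set"
  have "compactin (product_topology (\<lambda>_. euclidean) UNIV) ?B"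
    by (subst compactin_PiE) simp
  then have "compact ?B" by (simp add: euclidean_product_topology)
  moreover have "closed allocations"
    unfolding allocations_def Ball_def
    by (intro closed_Collect_conj closed_Collect_all closed_Collect_imp
        closed_Collect_le closed_Collect_eq open_Collect_const continuous_intros
        continuous_on_product_coordinates)
  moreover have "allocations \<subseteq> ?B"
  proof
    fix x assume x: "x \<in> allocations"
    then have x0: "0 \<le> x k" for k unfolding allocations_def by blast
    have "x (A, i) \<le> W" for A i
    proof (cases "A \<in> Pow J \<and> i \<in> J")
      case True
      then have "x (A, i) \<le> (\<Sum>A\<in>Pow J. x (A, i))"
        using finite_J x0 by (intro member_le_sum) auto
      also have "\<dots> = w i" using x True by (simp add: allocations_def)
      also have "\<dots> \<le> W" unfolding W_def using True finite_J w0 by (intro member_le_sum) auto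
      finally show ?thesis .
    next
      case False
      then have "x (A, i) = 0" using x by (auto simp: allocations_def)
      then show ?thesis unfolding W_def using w0 by (auto intro: sum_nonneg)
    qed
    with x0 show "x \<in> ?B" by auto
  qed
  ultimately show ?thesis by (metis compact_Int_closed inf.absorb2)
qed

text \<open>Cell lengths do not depend on \<open>x\<close>, so pooled speeds are linear in
  \<open>x\<close>; the power is continuous even at speed 0 because the exponent is
  positive.\<close>

lemma continuous_on_pooled_energy: "continuous_on allocations pooled_energy"
proof -
  have coord: "continuous_on allocations (\<lambda>x. x k)" for k :: "nat set \<times> nat"
    by (rule continuous_on_subset[OF continuous_on_product_coordinates]) simp
  have "continuous_on allocations (\<lambda>x. pooled_speed x A powr \<alpha>)" for A
  proof (cases "len A = 0")
    case True
    then show ?thesis by (simp add: pooled_speed_def)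
  next
    case False
    then show ?thesis unfolding pooled_speed_def using exponent
      by (intro continuous_on_powr' continuous_intros coord)
        (auto intro!: divide_nonneg_nonneg sum_nonneg simp: allocations_def)
  qed
  then show ?thesis
    unfolding pooled_energy_def by (intro continuous_on_sum continuous_on_mult_left)
qed

text \<open>\<open>OPT\<close> is a Hilbert choice and has the expected properties only once some
  minimizer exists. The schedule of an allocation minimizing \<open>pooled_energy\<close> is
  one.\<close>

lemma OPT_minimal:
  shows feasible_OPT: "feasible J w r d (OPT \<alpha> J w r d)"
    and energy_OPT_le: "feasible J w r d S \<Longrightarrow> energy \<alpha> (OPT \<alpha> J w r d) \<le> energy \<alpha> S"
    and energy_OPT_finite: "energy \<alpha> (OPT \<alpha> J w r d) < \<infinity>"
proof -
  obtain x where x: "x \<in> allocations" "\<And>y. y \<in> allocations \<Longrightarrow> pooled_energy x \<le> pooled_energy y"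
    using continuous_attains_inf[OF compact_allocations allocations_nonempty continuous_on_pooled_energy]
    by blast
  obtain S0 where S0: "feasible J w r d S0" "energy \<alpha> S0 = ennreal (pooled_energy x)"
    using allocation_schedule[OF x(1)] by blast
  have min: "energy \<alpha> S0 \<le> energy \<alpha> S" if S: "feasible J w r d S" for S
    using feasible_allocation[OF S] x(2) S0(2) by (metis ennreal_leI order_trans)
  then have "is_arg_min (energy \<alpha>) (feasible J w r d) S0"
    using S0(1) by (auto simp: is_arg_min_def not_less)
  then have opt: "is_arg_min (energy \<alpha>) (feasible J w r d) (OPT \<alpha> J w r d)"
    unfolding OPT_def arg_min_def by (rule someI)
  then show "feasible J w r d (OPT \<alpha> J w r d)"
    and "feasible J w r d S \<Longrightarrow> energy \<alpha> (OPT \<alpha> J w r d) \<le> energy \<alpha> S"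
    by (auto simp: is_arg_min_def not_less)
  have "energy \<alpha> (OPT \<alpha> J w r d) \<le> energy \<alpha> S0"
    using opt S0(1) by (auto simp: is_arg_min_def not_less)
  then show "energy \<alpha> (OPT \<alpha> J w r d) < \<infinity>"
    using S0(2) by (simp add: le_less_trans[OF _ ennreal_less_top])
qed

end

section \<open>Transferring schedules between nearby deadlines\<close>

text \<open>Cut at the threshold \<open>M\<close>: slower speeds are bounded by \<open>M\<close>,
  faster ones by \<open>M powr (1 - \<alpha>)\<close> times their power, since the exponent
  \<open>1 - \<alpha>\<close> is negative. Thus bounded energy forces little work on short
  sets.\<close>

lemma workload_in_le:
  assumes "wf_schedule S" "1 < \<alpha>" "0 < M" "I \<in> sets lebesgue"
  shows "workload_in S i I \<le> ennreal M * emeasure lebesgue I + ennreal (M powr (1 - \<alpha>)) * energy \<alpha> S"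
proof -
  have nonneg: "0 \<le> speed S t" for t using assms(1) by (simp add: wf_schedule_def)
  have [measurable]: "speed S \<in> borel_measurable lebesgue" using assms(1) by (simp add: wf_schedule_def)
  have "speed S t \<le> M + M powr (1 - \<alpha>) * speed S t powr \<alpha>" for t
  proof (cases "speed S t \<le> M")
    case False
    define s where "s = speed S t"
    have s: "M < s" using False by (simp add: s_def)
    have "s = s powr (1 - \<alpha>) * s powr \<alpha>"
      using s assms(3) by (simp add: powr_add[symmetric])
    also have "\<dots> \<le> M powr (1 - \<alpha>) * s powr \<alpha>"
      using s assms(2,3) by (intro mult_right_mono powr_mono2') auto
    finally show ?thesis using assms(3) by (simp add: s_def)
  qed (simp add: add_increasing2)
  then have "workload_in S i I \<le> (\<integral>\<^sup>+ t. ennreal M * indicator I t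
      + ennreal (M powr (1 - \<alpha>)) * ennreal (speed S t powr \<alpha>) \<partial>lebesgue)"
    unfolding workload_in_eq using assms(3)
    by (intro nn_integral_mono) (auto simp: indicator_def ennreal_mult[symmetric] ennreal_plus[symmetric]
        intro!: ennreal_leI simp del: ennreal_plus)
  also have "\<dots> = ennreal M * emeasure lebesgue I + ennreal (M powr (1 - \<alpha>)) * energy \<alpha> S"
    unfolding energy_def using assms(4)
    by (subst nn_integral_add) (auto simp: nn_integral_cmult nn_integral_cmult_indicator)
  finally show ?thesis .
qed

text \<open>If truncation at \<open>d\<close> leaves each job at least the fraction
  \<open>1 / c\<close> of its work, a per-job speed-up by at most \<open>c\<close> repairs the loss.
  The same \<delta> serves all \<open>d'\<close> and \<open>S\<close> obeying the energy bound
  \<open>C\<close>.\<close>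

lemma feasible_earlier_deadlines:
  fixes d :: "nat \<Rightarrow> real"
  assumes "1 < \<alpha>" "finite J" and w: "\<And>i. i \<in> J \<Longrightarrow> 0 < w i" and "1 < c" "0 \<le> C"
  shows "\<exists>\<delta>>0. \<forall>d' S. (\<forall>i\<in>J. d' i \<le> d i + \<delta>) \<longrightarrow> feasible J w r d' S \<longrightarrow> energy \<alpha> S \<le> ennreal C \<longrightarrow>
    (\<exists>S'. feasible J w r d S' \<and> energy \<alpha> S' \<le> ennreal (c powr \<alpha>) * energy \<alpha> S)"
proof -
  \<comment> \<open>A job losing at most \<eta> keeps at least \<open>w i / c\<close>. The inserted
    1 keeps the minimum defined when \<open>J\<close> is empty.\<close>
  define \<eta> :: real where "\<eta> = Min (insert 1 ((\<lambda>i. (1 - 1 / c) * w i) ` J))"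
  have \<eta>_pos: "0 < \<eta>"
    unfolding \<eta>_def using assms by (subst Min_gr_iff) auto
  have \<eta>_le: "\<eta> \<le> (1 - 1 / c) * w i" if "i \<in> J" for i
    unfolding \<eta>_def using assms that by (intro Min_le) auto
  \<comment> \<open>\<open>M\<close> and \<open>\<delta>\<close> make each of the two terms of \<open>workload_in_le\<close> at most \<open>\<eta> / 2\<close>.\<close>
  define M where "M = (\<eta> / (2 * (C + 1))) powr (1 / (1 - \<alpha>))"
  have M_pos: "0 < M" using \<eta>_pos \<open>0 \<le> C\<close> by (simp add: M_def)
  have "M powr (1 - \<alpha>) = \<eta> / (2 * (C + 1))"
    unfolding M_def using assms \<eta>_pos by (simp add: powr_powr)
  moreover have "C + 1 \<noteq> 0" using \<open>0 \<le> C\<close> by simp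
  ultimately have "M powr (1 - \<alpha>) * (C + 1) = \<eta> / 2"
    by (metis divide_divide_eq_left nonzero_eq_divide_eq)
  moreover have "M powr (1 - \<alpha>) * C \<le> M powr (1 - \<alpha>) * (C + 1)"
    by (intro mult_left_mono) auto
  ultimately have MC: "M powr (1 - \<alpha>) * C \<le> \<eta> / 2"
    by simp
  define \<delta> where "\<delta> = \<eta> / (2 * M)"
  have \<delta>: "0 < \<delta>" "M * \<delta> = \<eta> / 2" using \<eta>_pos M_pos by (auto simp: \<delta>_def)
  show ?thesis
  proof (intro exI[of _ \<delta>] conjI allI impI \<delta>(1))
    fix d' S assume d': "\<forall>i\<in>J. d' i \<le> d i + \<delta>" and S: "feasible J w r d' S"
      and energy: "energy \<alpha> S \<le> ennreal C"
    have wf: "wf_schedule S" using S by (simp add: feasible_def)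
    then have [measurable]: "speed S \<in> borel_measurable lebesgue" and nonneg: "\<And>t. 0 \<le> speed S t"
      and job_meas: "job S \<in> measurable lebesgue (count_space UNIV)"
      by (auto simp: wf_schedule_def)
    have job_sets: "{t. job S t = Some i} \<in> sets lebesgue" for i
      using measurable_sets[OF job_meas, of "{Some i}"] by (simp add: vimage_def)
    define q where "q i = enn2real (workload_in S i {r i..d i})" for i
    have q: "ennreal (q i) = workload_in S i {r i..d i}" "w i / c \<le> q i" if i: "i \<in> J" for i
    proof -
      have all: "workload_in S i UNIV = ennreal (w i)" using S i by (simp add: feasible_def)
      have "workload_in S i {r i..d i} \<le> ennreal (w i)"
        using workload_in_mono[of "{r i..d i}" UNIV S i] all by simp
      then show eq: "ennreal (q i) = workload_in S i {r i..d i}"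
        by (auto simp: q_def intro!: ennreal_enn2real le_less_trans[OF _ ennreal_less_top])
      \<comment> \<open>Lost work must lie here: any other time outside the window for
        \<open>d\<close> is also outside the one for \<open>d'\<close>, because \<open>d' i\<close>
        is at most \<open>d i + \<delta>\<close>.\<close>
      let ?L = "{d i..d i + \<delta>}"
      have "workload_in S i UNIV \<le> workload_in S i ({r i..d i} \<union> (- {r i..d i}))"
        by simp
      also have "\<dots> = ennreal (q i) + workload_in S i (- {r i..d i})"
        unfolding eq by (intro workload_in_Un wf) auto
      also have "workload_in S i (- {r i..d i}) \<le> workload_in S i (?L \<union> (- {r i..d' i} - ?L))"
        using d' i by (intro workload_in_mono) force
      also have "\<dots> = workload_in S i ?L + workload_in S i (- {r i..d' i} - ?L)"
        by (intro workload_in_Un wf) auto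
      also have "workload_in S i (- {r i..d' i} - ?L) = 0"
        by (intro feasible_workload_outside[OF S i]) auto
      also have "workload_in S i ?L \<le> ennreal M * emeasure lebesgue ?L + ennreal (M powr (1 - \<alpha>)) * energy \<alpha> S"
        using M_pos assms by (intro workload_in_le wf) auto
      also have "\<dots> \<le> ennreal M * ennreal \<delta> + ennreal (M powr (1 - \<alpha>)) * ennreal C"
        using energy \<delta>(1) by (intro add_mono mult_left_mono) auto
      also have "\<dots> = ennreal (M * \<delta> + M powr (1 - \<alpha>) * C)"
        using M_pos \<delta> \<open>0 \<le> C\<close> by (simp add: ennreal_mult ennreal_plus)
      also have "\<dots> \<le> ennreal \<eta>"
        using MC \<delta>(2) by (intro ennreal_leI) linarith
      finally have "ennreal (w i) \<le> ennreal (q i + \<eta>)"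
        using \<eta>_pos by (simp add: all q_def add_left_mono)
      then have "w i \<le> q i + \<eta>"
        using \<eta>_pos by (subst (asm) ennreal_le_iff) (auto simp: q_def)
      with \<eta>_le[OF i] show "w i / c \<le> q i" by (simp add: algebra_simps)
    qed
    have q_pos: "0 < q i" if "i \<in> J" for i
    proof -
      have "0 < w i / c" using w[OF that] \<open>1 < c\<close> by simp
      with q(2)[OF that] show ?thesis by linarith
    qed
    \<comment> \<open>The factor that restores the full workload from what survives
      truncation.\<close>
    define k where "k i = w i / q i" for i
    have k: "0 \<le> k i" "k i \<le> c" "k i * q i = w i" if "i \<in> J" for i
      using q(2)[OF that] q_pos[OF that] w[OF that] \<open>1 < c\<close> by (auto simp: k_def field_simps)
    \<comment> \<open>The job function is kept, and the speed drops to 0 whenever the processed job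
      is outside its window. At most one summand is nonzero at a time.\<close>
    define v where "v t = (\<Sum>i\<in>J. k i * indicator ({t. job S t = Some i} \<inter> {r i..d i}) t * speed S t)" for t
    have v_Some: "v t = k i * indicator {r i..d i} t * speed S t" if "i \<in> J" "job S t = Some i" for i t
    proof -
      have "v t = (\<Sum>j\<in>J. if i = j then k i * indicator {r i..d i} t * speed S t else 0)"
        unfolding v_def using that by (intro sum.cong) (auto simp: indicator_def)
      then show ?thesis using that \<open>finite J\<close> by simp
    qed
    have v_bounds: "0 \<le> v t \<and> v t \<le> c * speed S t" for t
    proof (cases "job S t")
      case None
      then show ?thesis using nonneg \<open>1 < c\<close> by (auto simp: v_def)
    next
      case (Some i)
      then have "i \<in> J" using S by (auto simp: feasible_def)
      then show ?thesis using v_Some[OF _ Some] k[of i] nonneg[of t] \<open>1 < c\<close>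
        by (auto simp: indicator_def intro: mult_right_mono)
    qed
    define S' where "S' = S\<lparr>speed := v\<rparr>"
    have "v \<in> borel_measurable lebesgue"
      unfolding v_def using job_sets
      by (intro borel_measurable_sum borel_measurable_times borel_measurable_indicator) auto
    then have wf': "wf_schedule S'"
      using job_meas v_bounds by (simp add: wf_schedule_def S'_def)
    have "workload_in S' i I = ennreal (w i)" if i: "i \<in> J" and I: "{r i..d i} \<subseteq> I" for i I
    proof -
      have "workload_in S' i I = (\<integral>\<^sup>+ t. ennreal (k i) *
          (ennreal (speed S t) * indicator {t. job S t = Some i} t * indicator {r i..d i} t) \<partial>lebesgue)"
        unfolding workload_in_eq using v_Some[OF i] I k(1)[OF i] nonneg
        by (intro nn_integral_cong) (auto simp: indicator_def S'_def ennreal_mult)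
      also have "\<dots> = ennreal (k i) * workload_in S i {r i..d i}"
        unfolding workload_in_eq
        by (intro nn_integral_cmult borel_measurable_times_ennreal workload_integrand_measurable[OF wf]
            borel_measurable_indicator) simp
      also have "\<dots> = ennreal (w i)"
        using k[OF i] q_pos[OF i] by (simp add: q(1)[OF i, symmetric] ennreal_mult'[symmetric])
      finally show ?thesis .
    qed
    then have "feasible J w r d S'"
      using wf' S by (auto simp: feasible_def S'_def)
    moreover have "energy \<alpha> S' \<le> ennreal (c powr \<alpha>) * energy \<alpha> S"
    proof -
      have "energy \<alpha> S' \<le> (\<integral>\<^sup>+ t. ennreal (c powr \<alpha>) * ennreal (speed S t powr \<alpha>) \<partial>lebesgue)"
        unfolding energy_def
      proof (intro nn_integral_mono)
        fix t
        have "v t powr \<alpha> \<le> (c * speed S t) powr \<alpha>"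
          using v_bounds assms(1) by (intro powr_mono2) auto
        then show "ennreal (speed S' t powr \<alpha>) \<le> ennreal (c powr \<alpha>) * ennreal (speed S t powr \<alpha>)"
          using \<open>1 < c\<close> nonneg[of t]
          by (auto simp: S'_def powr_mult ennreal_mult[symmetric] intro!: ennreal_leI)
      qed
      also have "\<dots> = ennreal (c powr \<alpha>) * energy \<alpha> S"
        unfolding energy_def by (intro nn_integral_cmult) measurable
      finally show ?thesis .
    qed
    ultimately show "\<exists>S'. feasible J w r d S' \<and> energy \<alpha> S' \<le> ennreal (c powr \<alpha>) * energy \<alpha> S"
      by blast
  qed
qed

section \<open>Limits of deadlines and the minimum of the potential\<close>

definition opt_energy ::
    "real \<Rightarrow> nat set \<Rightarrow> (nat \<Rightarrow> real) \<Rightarrow> (nat \<Rightarrow> real) \<Rightarrow> (nat \<Rightarrow> real) \<Rightarrow> real" where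
  "opt_energy \<alpha> J w r d = enn2real (energy \<alpha> (OPT \<alpha> J w r d))"

definition potential ::
    "real \<Rightarrow> nat set \<Rightarrow> (nat \<Rightarrow> real) \<Rightarrow> (nat \<Rightarrow> real) \<Rightarrow> (nat \<Rightarrow> real) \<Rightarrow> (nat \<Rightarrow> real) \<Rightarrow> real" where
  "potential \<alpha> J w r p d = (\<Sum>i\<in>J. p i * d i) + opt_energy \<alpha> J w r d"

text \<open>Lower semicontinuity, phrased with upper bounds \<open>b\<close> so that the optimal
  energies themselves need not converge. The limit deadlines exceed the release times since positive
  work cannot be done in a null window.\<close>

lemma opt_energy_limit_le:
  assumes \<alpha>: "1 < \<alpha>" and "finite J" and w: "\<And>i. i \<in> J \<Longrightarrow> 0 < w i"
    and D: "\<And>k. strategy_profile J r (D k)" "\<And>i. i \<in> J \<Longrightarrow> (\<lambda>k. D k i) \<longlonglongrightarrow> d i"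
    and b: "\<And>k. opt_energy \<alpha> J w r (D k) \<le> b k" "b \<longlonglongrightarrow> K"
  shows "strategy_profile J r d" and "opt_energy \<alpha> J w r d \<le> K"
proof -
  have inst: "deadline_instance \<alpha> J w r d'" if "strategy_profile J r d'" for d'
    using that assms by unfold_locales (auto simp: strategy_profile_def)
  \<comment> \<open>A convergent sequence is bounded; this energy bound lets one \<delta> serve all
    \<open>k\<close>.\<close>
  obtain C where C: "0 \<le> C" "\<And>k. \<bar>b k\<bar> \<le> C"
    using convergent_imp_Bseq[of b] b(2) 
    by (auto simp: convergent_def Bseq_def intro: less_imp_le)
  have OPT_D: "energy \<alpha> (OPT \<alpha> J w r (D k)) = ennreal (opt_energy \<alpha> J w r (D k))" for k
    using deadline_instance.energy_OPT_finite[OF inst[OF D(1)], of k] by (simp add: opt_energy_def)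
  have approx: "\<forall>\<^sub>F k in sequentially. \<exists>S. feasible J w r d S \<and> energy \<alpha> S \<le> ennreal (c powr \<alpha> * b k)"
    if "1 < c" for c
  proof -
    obtain \<delta> where "\<delta> > 0" and \<delta>: "\<And>d' S. \<forall>i\<in>J. d' i \<le> d i + \<delta> \<Longrightarrow> feasible J w r d' S \<Longrightarrow>
        energy \<alpha> S \<le> ennreal C \<Longrightarrow>
        \<exists>S'. feasible J w r d S' \<and> energy \<alpha> S' \<le> ennreal (c powr \<alpha>) * energy \<alpha> S"
      using feasible_earlier_deadlines[of \<alpha> J w c C d r, OF \<alpha> \<open>finite J\<close> w \<open>1 < c\<close>] C(1) by auto
    have "\<forall>\<^sub>F k in sequentially. \<forall>i\<in>J. D k i < d i + \<delta>"
      using D(2) \<open>\<delta> > 0\<close> \<open>finite J\<close> by (intro eventually_ball_finite ballI order_tendstoD(2)) auto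
    then show ?thesis
    proof eventually_elim
      case (elim k)
      have "opt_energy \<alpha> J w r (D k) \<le> C" using b(1)[of k] C(2)[of k] by linarith
      then obtain S where S: "feasible J w r d S"
          "energy \<alpha> S \<le> ennreal (c powr \<alpha>) * energy \<alpha> (OPT \<alpha> J w r (D k))"
        using \<delta>[of "D k" "OPT \<alpha> J w r (D k)"] elim deadline_instance.feasible_OPT[OF inst[OF D(1)], of k]
        by (auto simp: OPT_D less_imp_le ennreal_leI)
      note S(2)
      also have "ennreal (c powr \<alpha>) * energy \<alpha> (OPT \<alpha> J w r (D k)) \<le> ennreal (c powr \<alpha> * b k)"
        using b(1)[of k] by (auto simp: OPT_D ennreal_mult'[symmetric] intro!: ennreal_leI mult_left_mono)
      finally show ?case using S(1) by blast
    qed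
  qed
  \<comment> \<open>Any \<open>c\<close> above 1 would do: only some schedule feasible for the limit
    is wanted, before \<open>d\<close> is known to be a strategy profile.\<close>
  obtain S where S: "feasible J w r d S"
    using eventually_happens[OF approx[of 2]] by auto
  show profile: "strategy_profile J r d"
    unfolding strategy_profile_def
  proof
    fix i assume i: "i \<in> J"
    show "d i \<in> {r i<..}"
    proof (rule ccontr)
      assume "d i \<notin> {r i<..}"
      then have "workload_in S i {r i..d i} = 0"
        by (intro workload_in_null) (auto simp: emeasure_lborel_Icc_eq)
      then show False using S i w[OF i] by (simp add: feasible_def)
    qed
  qed
  have b0: "0 \<le> b k" for k using b(1)[of k] by (simp add: opt_energy_def order_trans[OF enn2real_nonneg])
  have "opt_energy \<alpha> J w r d \<le> c powr \<alpha> * K" if "1 < c" for c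
  proof (rule tendsto_lowerbound)
    show "(\<lambda>k. c powr \<alpha> * b k) \<longlonglongrightarrow> c powr \<alpha> * K" by (intro tendsto_intros b)
    show "\<forall>\<^sub>F k in sequentially. opt_energy \<alpha> J w r d \<le> c powr \<alpha> * b k"
      using approx[OF that]
    proof eventually_elim
      case (elim k)
      then have "energy \<alpha> (OPT \<alpha> J w r d) \<le> ennreal (c powr \<alpha> * b k)"
        using deadline_instance.energy_OPT_le[OF inst[OF profile]] order_trans by blast
      then show ?case
        unfolding opt_energy_def using b0 by (intro enn2real_leI) auto
    qed
  qed simp
  \<comment> \<open>The limit in \<open>k\<close> was taken for fixed \<open>c\<close>; letting
    \<open>c\<close> decrease to 1 now removes the speed-up factor.\<close>
  then have "\<forall>\<^sub>F c in at_right 1. opt_energy \<alpha> J w r d \<le> c powr \<alpha> * K"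
    by (auto simp: eventually_at_right_field intro: exI[of _ 2])
  moreover have "((\<lambda>c. c powr \<alpha> * K) \<longlongrightarrow> 1 powr \<alpha> * K) (at_right 1)"
    by (intro tendsto_intros) auto
  ultimately show "opt_energy \<alpha> J w r d \<le> K"
    using tendsto_lowerbound by fastforce
qed

text \<open>Direct method: the terms \<open>p i * d i\<close> confine a minimizing sequence to a
  box, and semicontinuity passes to the limit. Deadlines of non-players are fixed at 0 so that the
  box is compact.\<close>

lemma potential_attains_minimum:
  assumes \<alpha>: "1 < \<alpha>" and "finite J" and w: "\<And>i. i \<in> J \<Longrightarrow> 0 < w i" and p: "\<And>i. i \<in> J \<Longrightarrow> 0 < p i"
  shows "\<exists>d. strategy_profile J r d \<and> (\<forall>i. i \<notin> J \<longrightarrow> d i = 0) \<and>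
    (\<forall>d'. strategy_profile J r d' \<longrightarrow> (\<forall>i. i \<notin> J \<longrightarrow> d' i = 0) \<longrightarrow>
      potential \<alpha> J w r p d \<le> potential \<alpha> J w r p d')"
proof -
  define Z where "Z = {d. strategy_profile J r d \<and> (\<forall>i. i \<notin> J \<longrightarrow> d i = 0)}"
  let ?\<Phi> = "potential \<alpha> J w r p"
  have le: "(\<Sum>i\<in>J. p i * r i) \<le> (\<Sum>i\<in>J. p i * d i)" if "d \<in> Z" for d
    using that p by (intro sum_mono mult_left_mono) (auto simp: Z_def strategy_profile_def less_imp_le)
  have "(\<Sum>i\<in>J. p i * r i) \<le> ?\<Phi> d" if "d \<in> Z" for d
    using le[OF that] by (simp add: potential_def opt_energy_def add_increasing2)
  then have bdd: "bdd_below (?\<Phi> ` Z)" by (intro bdd_belowI2)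
  have "(\<lambda>i. if i \<in> J then r i + 1 else 0) \<in> Z" by (auto simp: Z_def strategy_profile_def)
  then have "Z \<noteq> {}" by blast
  define m where "m = Inf (?\<Phi> ` Z)"
  have "\<exists>d\<in>Z. ?\<Phi> d < m + 1 / real (Suc k)" for k
    using cInf_lessD[of "?\<Phi> ` Z" "m + 1 / real (Suc k)"] \<open>Z \<noteq> {}\<close> by (auto simp: m_def)
  then obtain D where D: "\<And>k. D k \<in> Z" "\<And>k. ?\<Phi> (D k) < m + 1 / real (Suc k)" by metis
  \<comment> \<open>Along the sequence the potential stays below \<open>m + 1\<close> and the energy
    is nonnegative, so every \<open>p i * (D k i - r i)\<close> is at most \<open>G\<close>.\<close>
  define G where "G = m + 1 - (\<Sum>i\<in>J. p i * r i)"
  \<comment> \<open>Compactness forces the box to contain the forbidden value \<open>r i\<close>;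
    the limit lemma excludes it afterwards.\<close>
  define B where "B = PiE UNIV (\<lambda>i. if i \<in> J then {r i..r i + G / p i} else {0::real})"
  have "compactin (product_topology (\<lambda>_. euclidean) UNIV) B"
    unfolding B_def by (subst compactin_PiE) auto
  then have "seq_compact B"
    by (simp add: euclidean_product_topology compact_imp_seq_compact)
  moreover have "D k \<in> B" for k
  proof -
    have "D k i \<le> r i + G / p i" if i: "i \<in> J" for i
    proof -
      have "p i * (D k i - r i) \<le> (\<Sum>i\<in>J. p i * (D k i - r i))"
        using i p D(1)[of k] \<open>finite J\<close>
        by (intro member_le_sum) (auto simp: Z_def strategy_profile_def intro!: mult_nonneg_nonneg less_imp_le)
      also have "\<dots> = (\<Sum>i\<in>J. p i * D k i) - (\<Sum>i\<in>J. p i * r i)"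
        by (simp add: right_diff_distrib sum_subtractf)
      also have "\<dots> \<le> ?\<Phi> (D k) - (\<Sum>i\<in>J. p i * r i)"
        by (simp add: potential_def opt_energy_def)
      also have "\<dots> \<le> G"
      proof -
        have "1 / real (Suc k) \<le> 1" by simp
        with D(2)[of k] show ?thesis unfolding G_def by linarith
      qed
      finally show ?thesis using p[OF i] by (simp add: field_simps)
    qed
    then show ?thesis using D(1)[of k]
      by (auto simp: B_def Z_def strategy_profile_def less_imp_le)
  qed
  ultimately obtain d \<phi> where d: "d \<in> B" "strict_mono \<phi>" "(D \<circ> \<phi>) \<longlonglongrightarrow> d"
    unfolding seq_compact_def by blast
  have coord: "(\<lambda>k. D (\<phi> k) i) \<longlonglongrightarrow> d i" for i
  proof -
    have "isCont (\<lambda>x. x i) d"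
      using continuous_on_product_coordinates[of i] by (metis UNIV_I continuous_on_eq_continuous_at open_UNIV)
    from isCont_tendsto_compose[OF this d(3)] show ?thesis by (simp add: o_def)
  qed
  \<comment> \<open>The bound on the potential minus its linear part: it bounds the optimal energy
    and converges together with the deadlines.\<close>
  let ?b = "\<lambda>k. m + 1 / real (Suc (\<phi> k)) - (\<Sum>i\<in>J. p i * D (\<phi> k) i)"
  have "(\<lambda>k. 1 / real (Suc (\<phi> k))) \<longlonglongrightarrow> 0"
    using LIMSEQ_subseq_LIMSEQ[OF LIMSEQ_inverse_real_of_nat d(2)] by (simp add: o_def inverse_eq_divide)
  then have b: "?b \<longlonglongrightarrow> m + 0 - (\<Sum>i\<in>J. p i * d i)"
    by (intro tendsto_intros coord)
  have bk: "opt_energy \<alpha> J w r (D (\<phi> k)) \<le> ?b k" for k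
    using D(2)[of "\<phi> k"] by (simp add: potential_def)
  have prof: "strategy_profile J r (D (\<phi> k))" for k using D(1) by (simp add: Z_def)
  note limit = opt_energy_limit_le[of \<alpha> J w r "\<lambda>k. D (\<phi> k)" d ?b, OF \<alpha> \<open>finite J\<close> w prof coord bk b]
  have "d i = 0" if "i \<notin> J" for i
    using PiE_mem[OF d(1)[unfolded B_def], of i] that by simp
  moreover have "?\<Phi> d \<le> ?\<Phi> d'" if "d' \<in> Z" for d'
  proof -
    have "?\<Phi> d \<le> m" using limit(2) by (simp add: potential_def)
    also have "m \<le> ?\<Phi> d'" unfolding m_def using that bdd by (intro cInf_lower) auto
    finally show ?thesis .
  qed
  ultimately show ?thesis using limit(1) by (auto simp: Z_def)
qed

section \<open>The exact potential property and the equilibrium\<close>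

lemma feasible_cong_deadlines:
  "(\<And>i. i \<in> J \<Longrightarrow> d i = d' i) \<Longrightarrow> feasible J w r d = feasible J w r d'"
  by (intro ext) (simp add: feasible_def)

text \<open>The optimum without job \<open>i\<close> does not see the deadline of \<open>i\<close>,
  so its energy cancels, as do the other players' linear terms.\<close>

lemma marginal_penalty_eq_potential:
  assumes "finite J" "i \<in> J"
  shows "marginal_penalty \<alpha> J w r p (d(i := x)) i - marginal_penalty \<alpha> J w r p d i =
    potential \<alpha> J w r p (d(i := x)) - potential \<alpha> J w r p d"
proof -
  have "OPT \<alpha> (J - {i}) w r (d(i := x)) = OPT \<alpha> (J - {i}) w r d"
    unfolding OPT_def by (subst feasible_cong_deadlines[of _ _ d]) auto
  moreover have "(\<Sum>j\<in>J. p j * (d(i := x)) j) = p i * x + (\<Sum>j\<in>J - {i}. p j * d j)"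
    using assms by (subst sum.remove[of J i]) auto
  moreover have "(\<Sum>j\<in>J. p j * d j) = p i * d i + (\<Sum>j\<in>J - {i}. p j * d j)"
    using assms by (intro sum.remove)
  ultimately show ?thesis
    by (simp add: marginal_penalty_def potential_def opt_energy_def)
qed

theorem mainTheorem2:
  fixes \<alpha> :: real and n :: nat and w r p :: "nat \<Rightarrow> real"
  assumes "\<alpha> \<in> {2..3}"
    and "n \<ge> 1"
    and "\<And>i. i \<in> {1..n} \<Longrightarrow> w i > 0"
    and "\<And>i. i \<in> {1..n} \<Longrightarrow> p i > 0"
  shows "\<exists>d :: nat \<Rightarrow> real. pure_Nash_equilibrium \<alpha> {1..n} w r p d"
proof -
  let ?J = "{1..n}"
  have "1 < \<alpha>" using assms(1) by simp
  then obtain d where d: "strategy_profile ?J r d" "\<And>i. i \<notin> ?J \<Longrightarrow> d i = 0"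
    and min: "\<And>d'. strategy_profile ?J r d' \<Longrightarrow> (\<And>i. i \<notin> ?J \<Longrightarrow> d' i = 0) \<Longrightarrow>
      potential \<alpha> ?J w r p d \<le> potential \<alpha> ?J w r p d'"
    using potential_attains_minimum[of \<alpha> ?J w p r] assms(3,4) by blast
  have "marginal_penalty \<alpha> ?J w r p d i \<le> marginal_penalty \<alpha> ?J w r p (d(i := x)) i"
    if "i \<in> ?J" "x \<in> {r i<..}" for i x
  proof -
    \<comment> \<open>Minimality holds among profiles vanishing off the player set; a deviation by a
      player stays in that class.\<close>
    have "potential \<alpha> ?J w r p d \<le> potential \<alpha> ?J w r p (d(i := x))"
      using d that by (intro min) (auto simp: strategy_profile_def)
    with marginal_penalty_eq_potential[of ?J i \<alpha> w r p d x] that(1) show ?thesis by simp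
  qed
  then have "pure_Nash_equilibrium \<alpha> ?J w r p d"
    using d(1) by (auto simp: pure_Nash_equilibrium_def not_less[symmetric])
  then show ?thesis by blast
qed

end
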